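(* Let $n\ge 5$ and let $S_n$ be the symmetric group on $n$ letters. Then the difference graph $\mathcal{D}(S_n)$ is a chordal graph if and only if $n=5$.
   Context: Difference graph: for a finite group $G$, the power graph $\mathcal{P}(G)$ is the simple undirected graph with vertex set $G$ in which distinct $a,b$ are adjacent iff $a\in\langle b\rangle$ or $b\in\langle a\rangle$. The enhanced power graph $\mathcal{P}_E(G)$ is the simple undirected graph with vertex set $G$ in which distinct $a,b$ are adjacent iff $a,b\in\langle c\rangle$ for some $c\in G$. The difference graph $\mathcal{D}(G)$ is obtained from the graph $\mathcal{P}_E(G)-\mathcal{P}(G)$ (vertex set $G$; two vertices are adjacent iff they are adjacent in $\mathcal{P}_E(G)$ but not in $\mathcal{P}(G)$) by removing all isolated vertices. A graph is chordal if it has no induced subgraph isomorphic to a cycle $C_m$ with $m\ge4$. *)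

theory Defs
  imports "HOL-Algebra.Sym_Groups" "HOL-Algebra.Generated_Groups" "Graph_Theory.Graph_Theory"
begin

text \<open>
  A simple undirected graph is represented as a symmetric, loop-free pair digraph
  (locale \<^locale>\<open>pair_graph\<close> in the finite case): an edge is a pair of opposite arcs.
\<close>

definition power_graph :: "('a, 'b) monoid_scheme \<Rightarrow> 'a pair_pre_digraph" where
  "power_graph G = \<lparr> pverts = carrier G,
     parcs = {(a, b). a \<in> carrier G \<and> b \<in> carrier G \<and> a \<noteq> b \<and>
                      (a \<in> generate G {b} \<or> b \<in> generate G {a})} \<rparr>"

definition enhanced_power_graph :: "('a, 'b) monoid_scheme \<Rightarrow> 'a pair_pre_digraph" where
  "enhanced_power_graph G = \<lparr> pverts = carrier G,
     parcs = {(a, b). a \<in> carrier G \<and> b \<in> carrier G \<and> a \<noteq> b \<and>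
                      (\<exists>c \<in> carrier G. a \<in> generate G {c} \<and> b \<in> generate G {c})} \<rparr>"

definition remove_edges_of :: "'a pair_pre_digraph \<Rightarrow> 'a pair_pre_digraph \<Rightarrow> 'a pair_pre_digraph" where
  "remove_edges_of \<Gamma> \<Delta> = \<lparr> pverts = pverts \<Gamma>, parcs = parcs \<Gamma> - parcs \<Delta> \<rparr>"

definition remove_isolated :: "'a pair_pre_digraph \<Rightarrow> 'a pair_pre_digraph" where
  "remove_isolated \<Gamma> =
     \<lparr> pverts = {v \<in> pverts \<Gamma>. \<exists>w. (v, w) \<in> parcs \<Gamma> \<or> (w, v) \<in> parcs \<Gamma>}, parcs = parcs \<Gamma> \<rparr>"

definition difference_graph :: "('a, 'b) monoid_scheme \<Rightarrow> 'a pair_pre_digraph" where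
  "difference_graph G = remove_isolated (remove_edges_of (enhanced_power_graph G) (power_graph G))"

text \<open>The cycle on \<open>m\<close> vertices; only meaningful for \<open>m \<ge> 3\<close>.\<close>

definition cycle_graph :: "nat \<Rightarrow> nat pair_pre_digraph" where
  "cycle_graph m = \<lparr> pverts = {..<m},
     parcs = {(i, j). i < m \<and> j < m \<and> (j = Suc i mod m \<or> i = Suc j mod m)} \<rparr>"

definition chordal :: "'a pair_pre_digraph \<Rightarrow> bool" where
  "chordal \<Gamma> \<longleftrightarrow>
     \<not> (\<exists>H m. 4 \<le> m \<and> induced_subgraph H (with_proj \<Gamma>) \<and> digraph_iso H (with_proj (cycle_graph m)))"

text \<open>
  The library's \<^const>\<open>induced_subgraph\<close> and \<^const>\<open>digraph_iso\<close> presuppose well-formed graphs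
  (otherwise \<^const>\<open>chordal\<close> would hold vacuously); the graphs used here are indeed simple graphs.
\<close>

lemma pair_graph_difference_graph:
  assumes "finite (carrier G)"
  shows "pair_graph (difference_graph G)"
proof
  have "parcs (difference_graph G) \<subseteq> carrier G \<times> carrier G"
    by (auto simp: difference_graph_def remove_isolated_def remove_edges_of_def enhanced_power_graph_def)
  then show "finite (parcs (difference_graph G))"
    using assms by (meson finite_SigmaI finite_subset)
  show "symmetric (with_proj (difference_graph G))"
    by (auto simp: symmetric_def sym_def difference_graph_def remove_isolated_def remove_edges_of_def
        enhanced_power_graph_def power_graph_def)
  have *: "fst e \<in> pverts (difference_graph G) \<and> snd e \<in> pverts (difference_graph G) \<and> fst e \<noteq> snd e"
    if "e \<in> parcs (difference_graph G)" for e
  proof -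
    obtain a b where e: "e = (a, b)" by (cases e)
    from that have ab: "a \<in> carrier G" "b \<in> carrier G" "a \<noteq> b"
      by (auto simp: e difference_graph_def remove_isolated_def remove_edges_of_def enhanced_power_graph_def)
    moreover have "pverts (difference_graph G) =
        {v \<in> carrier G. \<exists>w. (v, w) \<in> parcs (difference_graph G) \<or> (w, v) \<in> parcs (difference_graph G)}"
      by (simp add: difference_graph_def remove_isolated_def remove_edges_of_def enhanced_power_graph_def)
    ultimately show ?thesis
      using that by (auto simp: e)
  qed
  show "fst e \<in> pverts (difference_graph G)" "snd e \<in> pverts (difference_graph G)" "fst e \<noteq> snd e"
    if "e \<in> parcs (difference_graph G)" for e
    using *[OF that] by auto
  show "finite (pverts (difference_graph G))"
    using assms by (simp add: difference_graph_def remove_isolated_def remove_edges_of_def enhanced_power_graph_def)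
qed

lemma pair_graph_cycle_graph:
  assumes "3 \<le> m"
  shows "pair_graph (cycle_graph m)"
proof
  have "parcs (cycle_graph m) \<subseteq> {..<m} \<times> {..<m}"
    by (auto simp: cycle_graph_def)
  then show "finite (parcs (cycle_graph m))"
    by (meson finite_SigmaI finite_lessThan finite_subset)
  show "symmetric (with_proj (cycle_graph m))"
    by (auto simp: symmetric_def sym_def cycle_graph_def)
  show "fst e \<noteq> snd e" if "e \<in> parcs (cycle_graph m)" for e
    using that assms by (auto simp: cycle_graph_def mod_Suc split: if_splits)
qed (auto simp: cycle_graph_def)

end

theory Submission
  imports Defs "HOL-Algebra.Multiplicative_Group"
begin

text \<open>
  In \<open>S\<^sub>5\<close> every permutation has order dividing 4, 5 or 6, and only an order divisible by two primes
  yields two incomparable subgroups of a cyclic group. Hence each edge of the difference graph joins a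
  commuting pair consisting of an involution and an element of order 3. An element of order 3 in
  \<open>S\<^sub>5\<close> commutes with only one involution, the transposition of its two fixed points. So there is
  no path on four vertices, hence no cycle. For \<open>n \<ge> 6\<close> the vertices
  \<open>(1 2), (3 4 5), (1 6), (3 5 4)\<close> form an induced 4-cycle.
\<close>

section \<open>Chordality and short paths\<close>

text \<open>Vertices 0, 1, 2, 3 of an induced cycle of length at least 4, pulled back along the
  isomorphism, form such a path. Excluding these paths is how chordality is proved for
  \<open>n = 5\<close>.\<close>

lemma not_chordal_path:
  assumes "\<not> chordal \<Gamma>"
  obtains a b c d where "(a, b) \<in> parcs \<Gamma>" "(b, c) \<in> parcs \<Gamma>" "(c, d) \<in> parcs \<Gamma>" "a \<noteq> c" "b \<noteq> d"
proof -
  obtain H m where m: "4 \<le> m" and ind: "induced_subgraph H (with_proj \<Gamma>)"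
    and "digraph_iso H (with_proj (cycle_graph m))"
    using assms by (auto simp: chordal_def)
  then obtain f where f: "pre_digraph.digraph_isomorphism H f"
    and C: "with_proj (cycle_graph m) = app_iso f H"
    by (auto simp: digraph_iso_def)
  have HG: "arcs H \<subseteq> parcs \<Gamma>" "tail H = fst" "head H = snd" "wf_digraph H"
    using ind by (auto simp: induced_subgraph_def subgraph_def compatible_def)
  \<comment> \<open>\<open>g\<close> inverts the vertex map: \<open>g i\<close> is the vertex of
    \<open>H\<close> at position \<open>i\<close> of the cycle.\<close>
  define g where "g = the_inv_into (verts H) (iso_verts f)"
  have inj: "inj_on (iso_verts f) (verts H)"
    using f by (simp add: pre_digraph.digraph_isomorphism_def)
  have vs: "iso_verts f ` verts H = {..<m}"
    using arg_cong[OF C, of verts] by (simp add: cycle_graph_def)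
  have arc: "(g i, g (Suc i)) \<in> parcs \<Gamma>" if "Suc i < m" for i
  proof -
    have "(i, Suc i) \<in> arcs (app_iso f H)"
      using that by (simp flip: C) (simp add: cycle_graph_def)
    then obtain e where e: "e \<in> arcs H" "iso_arcs f e = (i, Suc i)"
      by auto
    have "iso_tail f = fst" "iso_head f = snd"
      using arg_cong[OF C, of tail] arg_cong[OF C, of head] by simp_all
    then have "iso_verts f (fst e) = i" "iso_verts f (snd e) = Suc i"
      using f e HG by (auto simp: pre_digraph.digraph_isomorphism_def)
    moreover have "fst e \<in> verts H" "snd e \<in> verts H"
      using wf_digraph.wellformed[OF HG(4) e(1)] HG by simp_all
    ultimately have "g i = fst e" "g (Suc i) = snd e"
      using the_inv_into_f_f[OF inj, of "fst e"] the_inv_into_f_f[OF inj, of "snd e"]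
      by (simp_all add: g_def)
    then show ?thesis
      using e(1) HG(1) by auto
  qed
  have "inj_on g {..<m}"
    unfolding g_def using inj_on_the_inv_into[OF inj] by (simp add: vs)
  then have "g 0 \<noteq> g 2" "g 1 \<noteq> g 3"
    using m by (auto dest: inj_onD)
  then show ?thesis
    using that[of "g 0" "g 1" "g 2" "g 3"] arc[of 0] arc[of 1] arc[of 2] m
    by (simp add: numeral_eq_Suc)
qed

text \<open>The subgraph induced on the four vertices is itself a copy of
  \<open>cycle_graph 4\<close>, via an explicit relabelling.\<close>

lemma induced_four_cycle_not_chordal:
  assumes "pair_graph \<Gamma>"
    and "(a, b) \<in> parcs \<Gamma>" "(b, c) \<in> parcs \<Gamma>" "(c, d) \<in> parcs \<Gamma>" "(d, a) \<in> parcs \<Gamma>"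
    and "(a, c) \<notin> parcs \<Gamma>" "(b, d) \<notin> parcs \<Gamma>" "a \<noteq> c" "b \<noteq> d"
  shows "\<not> chordal \<Gamma>"
proof -
  interpret pair_graph \<Gamma> by fact
  define H where "H = with_proj \<Gamma> \<restriction> {a, b, c, d}"
  \<comment> \<open>\<open>f\<close> numbers the vertices in cyclic order; the default value 3 is
    the label of \<open>d\<close>.\<close>
  define f where "f = (\<lambda>x. if x = a then 0 else if x = b then 1 else if x = c then 2 else 3 :: nat)"
  define h where "h = \<lparr>iso_verts = f, iso_arcs = map_prod f f, iso_head = snd, iso_tail = fst\<rparr>"
  have sym: "(y, x) \<in> parcs \<Gamma>" if "(x, y) \<in> parcs \<Gamma>" for x y
    using that arcs_symmetric by blast
  have irrefl: "(x, x) \<notin> parcs \<Gamma>" for x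
    using no_loops[of "(x, x)"] by auto
  have ne: "a \<noteq> b" "b \<noteq> c" "c \<noteq> d" "d \<noteq> a"
    using assms irrefl by auto
  have V: "{a, b, c, d} \<subseteq> pverts \<Gamma>"
    using assms in_arcsD1 in_arcsD2 by blast
  have ind: "induced_subgraph H (with_proj \<Gamma>)"
    using V unfolding H_def by (intro induced_induce) simp
  have f: "f a = 0" "f b = 1" "f c = 2" "f d = 3"
    using ne assms(8,9) by (auto simp: f_def)
  \<comment> \<open>Symmetry, absence of loops and the two missing diagonals decide all sixteen
    ordered pairs of vertices.\<close>
  have arcsH: "arcs H = {(a, b), (b, a), (b, c), (c, b), (c, d), (d, c), (d, a), (a, d)}"
  proof -
    have "(x, y) \<in> arcs H \<longleftrightarrow>
        (x, y) \<in> {(a, b), (b, a), (b, c), (c, b), (c, d), (d, c), (d, a), (a, d)}" for x y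
    proof (cases "x \<in> {a, b, c, d} \<and> y \<in> {a, b, c, d}")
      case True
      have pos: "(a, b) \<in> parcs \<Gamma>" "(b, c) \<in> parcs \<Gamma>" "(c, d) \<in> parcs \<Gamma>" "(d, a) \<in> parcs \<Gamma>"
        "(b, a) \<in> parcs \<Gamma>" "(c, b) \<in> parcs \<Gamma>" "(d, c) \<in> parcs \<Gamma>" "(a, d) \<in> parcs \<Gamma>"
        using assms(2-5) sym by blast+
      have neg: "(a, c) \<notin> parcs \<Gamma>" "(b, d) \<notin> parcs \<Gamma>" "(c, a) \<notin> parcs \<Gamma>" "(d, b) \<notin> parcs \<Gamma>"
        using assms(6,7) sym by blast+
      have H: "(x, y) \<in> arcs H \<longleftrightarrow> (x, y) \<in> parcs \<Gamma>"
        using True by (simp add: H_def induce_subgraph_def)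
      have "x = a \<or> x = b \<or> x = c \<or> x = d" "y = a \<or> y = b \<or> y = c \<or> y = d"
        using True by blast+
      then show ?thesis
        unfolding H
        by (elim disjE; simp add: pos neg irrefl ne ne[symmetric] assms(8,9) assms(8,9)[symmetric])
    next
      case False
      then show ?thesis
        by (simp add: H_def induce_subgraph_def) blast
    qed
    then show ?thesis
      by (simp only: set_eq_iff split_paired_All simp_thms)
  qed
  have vertsH: "verts H = {a, b, c, d}"
    by (simp add: H_def)
  have ends: "tail H = fst" "head H = snd"
    by (simp_all add: H_def induce_subgraph_def)
  have injf: "inj_on f {a, b, c, d}"
    by (auto simp: inj_on_def f)
  have "inj_on (map_prod f f) (arcs H)"
    by (rule inj_on_subset[OF map_prod_inj_on[OF injf injf]]) (auto simp: arcsH)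
  then have "pre_digraph.digraph_isomorphism H h"
    using ind injf
    by (auto simp: pre_digraph.digraph_isomorphism_def h_def vertsH ends induced_subgraph_def subgraph_def)
  moreover have "with_proj (cycle_graph 4) = app_iso h H"
  proof (rule pre_digraph.equality)
    show "verts (with_proj (cycle_graph 4)) = verts (app_iso h H)"
      by (auto simp: cycle_graph_def h_def vertsH f)
    \<comment> \<open>Filtering a finite product makes the arc set executable, so that it can be
      listed by evaluation.\<close>
    have "parcs (cycle_graph 4) = Set.filter (\<lambda>(i, j). j = Suc i mod 4 \<or> i = Suc j mod 4) ({..<4} \<times> {..<4})"
      by (auto simp: cycle_graph_def)
    also have "\<dots> = {(0, 1), (1, 0), (1, 2), (2, 1), (2, 3), (3, 2), (3, 0), (0, 3)}"
      by code_simp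
    finally show "arcs (with_proj (cycle_graph 4)) = arcs (app_iso h H)"
      by (simp add: h_def arcsH f)
  qed (simp_all add: h_def)
  ultimately show ?thesis
    using ind unfolding chordal_def digraph_iso_def by blast
qed

section \<open>Arcs of the difference graph\<close>

text \<open>Deleting isolated vertices removes no arc. All later arguments see the graph only
  through this criterion: a common cyclic subgroup, but neither end a power of the other.\<close>

lemma difference_graph_arc_iff:
  "(a, b) \<in> parcs (difference_graph G) \<longleftrightarrow>
    a \<in> carrier G \<and> b \<in> carrier G \<and> a \<noteq> b \<and> a \<notin> generate G {b} \<and> b \<notin> generate G {a} \<and>
    (\<exists>c \<in> carrier G. a \<in> generate G {c} \<and> b \<in> generate G {c})"
  by (auto simp: difference_graph_def remove_isolated_def remove_edges_of_def
      enhanced_power_graph_def power_graph_def)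

lemma difference_graph_arc_sym:
  "(a, b) \<in> parcs (difference_graph G) \<Longrightarrow> (b, a) \<in> parcs (difference_graph G)"
  by (auto simp: difference_graph_arc_iff)

context group
begin

text \<open>In a finite group inverses are natural powers, so natural exponents exhaust a cyclic
  subgroup.\<close>

lemma generate_singleton_iff:
  assumes "finite (carrier G)" "b \<in> carrier G"
  shows "a \<in> generate G {b} \<longleftrightarrow> (\<exists>k::nat. a = b [^] k)"
  using generate_pow_on_finite_carrier[OF assms] by auto

lemma pow_mod:
  fixes n k :: nat
  assumes "c \<in> carrier G" "c [^] n = \<one>"
  shows "c [^] (k mod n) = c [^] k"
proof -
  have "c [^] k = c [^] (n * (k div n) + k mod n)"
    by simp
  also have "\<dots> = c [^] (k mod n)"
    using assms by (simp only: nat_pow_mult[symmetric] nat_pow_pow[symmetric] nat_pow_one l_one nat_pow_closed)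
  finally show ?thesis by simp
qed

text \<open>Commuting elements of coprime orders 2 and 3 are both powers of their product, while a
  power of one that equals the other would be killed by both 2 and 3.\<close>

lemma difference_graph_arcI:
  assumes fin: "finite (carrier G)" and x: "x \<in> carrier G" and y: "y \<in> carrier G"
    and xy: "x \<otimes> y = y \<otimes> x"
    and x2: "x [^] (2::nat) = \<one>" and y3: "y [^] (3::nat) = \<one>" and ne: "x \<noteq> \<one>" "y \<noteq> \<one>"
  shows "(x, y) \<in> parcs (difference_graph G)"
proof -
  have pow: "(x \<otimes> y) [^] k = x [^] (k mod 2) \<otimes> y [^] (k mod 3)" for k :: nat
    using pow_mult_distrib[OF xy x y] pow_mod x2 y3 x y by simp
  \<comment> \<open>The exponents come from the Chinese remainder theorem: 3 is 1 mod 2 and 0 mod 3,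
    while 4 is 0 mod 2 and 1 mod 3.\<close>
  have "x = (x \<otimes> y) [^] (3::nat)" "y = (x \<otimes> y) [^] (4::nat)"
    unfolding pow using x y by simp_all
  moreover have "x \<noteq> y [^] k" for k :: nat
  proof
    assume "x = y [^] k"
    then have "x [^] (3::nat) = \<one>"
      using y y3 by (metis mult.commute nat_pow_one nat_pow_pow)
    then show False
      using pow_mod[OF x x2, of 3] x ne by simp
  qed
  moreover have "y \<noteq> x [^] k" for k :: nat
  proof
    assume "y = x [^] k"
    then have "y [^] (2::nat) = \<one>"
      using x x2 by (metis mult.commute nat_pow_one nat_pow_pow)
    then have "y [^] (4::nat) = \<one>"
      using nat_pow_pow[OF y, of 2 2] by simp
    then show False
      using pow_mod[OF y y3, of 4] y ne by simp
  qed
  moreover have "x \<noteq> y"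
    using calculation(3)[of 1] y by simp
  ultimately show ?thesis
    using x y fin unfolding difference_graph_arc_iff
    by (metis generate_singleton_iff m_closed)
qed

lemma difference_graph_arc_commute:
  assumes "finite (carrier G)" "(a, b) \<in> parcs (difference_graph G)"
  shows "a \<otimes> b = b \<otimes> a"
  using assms by (auto simp: difference_graph_arc_iff generate_singleton_iff nat_pow_mult add.commute)

text \<open>Both ends are powers of one \<open>c\<close>. Subgroups of a cyclic group of prime power
  order form a chain, so exponents 4 and 5 give no arc; for exponent 6 the only incomparable
  subgroups are those of orders 2 and 3. Each claim becomes a finite check on residues.\<close>

lemma difference_graph_arcD:
  assumes fin: "finite (carrier G)"
    and exp: "\<And>c. c \<in> carrier G \<Longrightarrow> c [^] (4::nat) = \<one> \<or> c [^] (5::nat) = \<one> \<or> c [^] (6::nat) = \<one>"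
    and arc: "(a, b) \<in> parcs (difference_graph G)"
  shows "a [^] (2::nat) = \<one> \<and> b [^] (3::nat) = \<one> \<or> a [^] (3::nat) = \<one> \<and> b [^] (2::nat) = \<one>"
proof -
  obtain c i j where c: "c \<in> carrier G" and ab: "a = c [^] (i::nat)" "b = c [^] (j::nat)"
    using arc fin by (auto simp: difference_graph_arc_iff generate_singleton_iff)
  have incomparable: "a \<noteq> b [^] k" "b \<noteq> a [^] k" for k :: nat
    using arc fin generate_singleton_iff by (auto simp: difference_graph_arc_iff)
  \<comment> \<open>Incomparability in terms of exponents: modulo any \<open>n\<close> that kills
    \<open>c\<close>, neither residue is a multiple of the other.\<close>
  have no: "((i mod n) * k) mod n \<noteq> j mod n" "((j mod n) * k) mod n \<noteq> i mod n"
    if n: "c [^] n = \<one>" for n k :: nat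
  proof -
    have eq: "c [^] x = c [^] y" if "x mod n = y mod n" for x y :: nat
      using pow_mod[OF c n, of x] pow_mod[OF c n, of y] that by simp
    have "c [^] (i * k) \<noteq> c [^] j" "c [^] (j * k) \<noteq> c [^] i"
      using incomparable[of k] unfolding ab nat_pow_pow[OF c] by simp_all
    then show "((i mod n) * k) mod n \<noteq> j mod n" "((j mod n) * k) mod n \<noteq> i mod n"
      using eq unfolding mod_mult_left_eq by blast+
  qed
  have not4: "c [^] (4::nat) \<noteq> \<one>"
  proof
    assume *: "c [^] (4::nat) = \<one>"
    \<comment> \<open>The chain of subgroups, checked on residues: of any two, one is a multiple of
      the other modulo 4.\<close>
    have "\<forall>i\<in>{..<4::nat}. \<forall>j\<in>{..<4}. \<exists>k\<in>{..<4}.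
        (i * k) mod 4 = j \<or> (j * k) mod 4 = i"
      by (simp add: lessThan_nat_numeral)
    moreover have "i mod 4 \<in> {..<4}" "j mod 4 \<in> {..<4}"
      by simp_all
    ultimately show False
      using no[OF *] by blast
  qed
  have not5: "c [^] (5::nat) \<noteq> \<one>"
  proof
    assume *: "c [^] (5::nat) = \<one>"
    have "\<forall>i\<in>{..<5::nat}. \<forall>j\<in>{..<5}. \<exists>k\<in>{..<5}.
        (i * k) mod 5 = j \<or> (j * k) mod 5 = i"
      by (simp add: lessThan_nat_numeral)
    moreover have "i mod 5 \<in> {..<5}" "j mod 5 \<in> {..<5}"
      by simp_all
    ultimately show False
      using no[OF *] by blast
  qed
  have 6: "c [^] (6::nat) = \<one>"
    using exp[OF c] not4 not5 by blast
  \<comment> \<open>Modulo 6 the incomparable pairs consist of 3 and one of 2, 4; they are killed by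
    2 and 3 respectively.\<close>
  have "\<forall>i\<in>{..<6::nat}. \<forall>j\<in>{..<6}.
      (\<exists>k\<in>{..<6}. (i * k) mod 6 = j \<or> (j * k) mod 6 = i) \<or>
      (i * 2) mod 6 = 0 \<and> (j * 3) mod 6 = 0 \<or> (i * 3) mod 6 = 0 \<and> (j * 2) mod 6 = 0"
    by (simp add: lessThan_nat_numeral)
  moreover have "i mod 6 \<in> {..<6}" "j mod 6 \<in> {..<6}"
    by simp_all
  ultimately have "((i mod 6) * 2) mod 6 = 0 \<and> ((j mod 6) * 3) mod 6 = 0 \<or>
      ((i mod 6) * 3) mod 6 = 0 \<and> ((j mod 6) * 2) mod 6 = 0"
    using no[OF 6] by blast
  then have "(i * 2) mod 6 = 0 \<and> (j * 3) mod 6 = 0 \<or> (i * 3) mod 6 = 0 \<and> (j * 2) mod 6 = 0"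
    by (simp only: mod_mult_left_eq)
  then show ?thesis
    using pow_mod[OF c 6] c unfolding ab by (metis nat_pow_0 nat_pow_pow)
qed

lemma difference_graph_arc_neq_one:
  assumes "(a, b) \<in> parcs (difference_graph G)"
  shows "a \<noteq> \<one>" "b \<noteq> \<one>"
  using assms generate.one by (auto simp: difference_graph_arc_iff)

end

section \<open>Permutations of few points\<close>

lemma sym_group_pow: "p [^]\<^bsub>sym_group n\<^esub> (k::nat) = p ^^ k"
  by (induction k) (simp_all add: nat_pow_def sym_group_def funpow_swap1 fun_eq_iff)

lemma finite_carrier_sym_group: "finite (carrier (sym_group n))"
  by (simp add: sym_group_def finite_permutations)

text \<open>The list \<open>support p a\<close> runs through the orbit of \<open>a\<close> without
  repetition, so orbit sizes can be read off as \<open>least_power\<close>.\<close>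

lemma card_support:
  assumes "permutation p"
  shows "card (set (support p a)) = least_power p a"
  using cycle_of_permutation[OF assms, of a] distinct_card by fastforce

text \<open>Points of one orbit differ by a power of \<open>p\<close>, which commutes with every
  other power, so what returns \<open>x\<close> to itself also returns \<open>y\<close>.\<close>

lemma least_power_on_support:
  assumes "permutation p" "y \<in> set (support p x)"
  shows "(p ^^ least_power p x) y = y"
proof -
  obtain i where "y = (p ^^ i) x"
    using assms by auto
  then have "(p ^^ least_power p x) y = (p ^^ i) ((p ^^ least_power p x) x)"
    by (metis add.commute comp_apply funpow_add)
  then show ?thesis
    using least_power_of_permutation(1)[OF assms(1)] \<open>y = (p ^^ i) x\<close> by simp
qed

text \<open>Distinct orbits are disjoint and share five points. Next to an orbit of length 4 or 5
  there is room only for fixed points; otherwise all lengths are at most 3 and divide 6.\<close>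

lemma sym_group_5_exponent:
  assumes p: "p permutes {1..5::nat}"
  shows "p ^^ 4 = id \<or> p ^^ 5 = id \<or> p ^^ 6 = id"
proof -
  have perm: "permutation p"
    using p permutation_permutes by blast
  let ?s = "\<lambda>x. set (support p x)"
  have sub: "?s x \<subseteq> {1..5}" if "x \<in> {1..5}" for x
    using permutes_in_funpow_image[OF p that] by auto
  have le5: "least_power p x \<le> 5" if "x \<in> {1..5}" for x
    using card_mono[OF _ sub[OF that]] by (simp add: card_support[OF perm] del: set_map)
  have two: "y \<in> ?s x \<or> least_power p x + least_power p y \<le> 5"
    if "x \<in> {1..5}" "y \<in> {1..5}" for x y
  proof (cases "y \<in> ?s x")
    case False
    then have "?s y \<inter> ?s x = {}"
      using disjoint_support'[OF perm] by blast
    then have "card (?s x \<union> ?s y) = least_power p x + least_power p y"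
      by (subst card_Un_disjoint) (auto simp: card_support[OF perm] simp del: set_map)
    moreover have "card (?s x \<union> ?s y) \<le> 5"
      using card_mono[of "{1..5::nat}" "?s x \<union> ?s y"] sub that by simp
    ultimately show ?thesis by simp
  qed simp
  have pos: "least_power p y > 0" for y
    using least_power_of_permutation(2)[OF perm] .
  \<comment> \<open>A power of \<open>p\<close> is trivial once its exponent is a multiple of every
    orbit length; points outside \<open>{1..5}\<close> are fixed anyway.\<close>
  have id: "p ^^ k = id" if "\<And>y. y \<in> {1..5} \<Longrightarrow> least_power p y dvd k" for k
  proof
    fix y
    show "(p ^^ k) y = id y"
    proof (cases "y \<in> {1..5}")
      case True
      then show ?thesis
        using that least_power_dvd[OF perm] by simp
    next
      case False
      then have "p y = y"
        using p by (meson permutes_not_in)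
      then show ?thesis
        by (induction k) auto
    qed
  qed
  show ?thesis
  proof (cases "\<exists>x \<in> {1..5}. least_power p x \<ge> 4")
    case True
    then obtain x where x: "x \<in> {1..5}" "least_power p x \<ge> 4" by blast
    have "least_power p y dvd least_power p x" if "y \<in> {1..5}" for y
    proof (cases "y \<in> ?s x")
      case True
      then show ?thesis
        using least_power_on_support[OF perm] least_power_dvd[OF perm] by blast
    next
      case False
      then have "least_power p y = 1"
        using two[OF x(1) that] x(2) pos[of y] by simp
      then show ?thesis by simp
    qed
    moreover have "least_power p x = 4 \<or> least_power p x = 5"
      using x le5[of x] by auto
    ultimately show ?thesis
      using id by metis
  next
    case False
    have "least_power p y dvd 6" if "y \<in> {1..5}" for y
    proof -
      have "least_power p y \<in> {1, 2, 3}"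
        using False that pos[of y] by force
      then show ?thesis by auto
    qed
    then show ?thesis
      using id by blast
  qed
qed

text \<open>With at most five points, \<open>x\<close> is a single 3-cycle. An involution commuting
  with it acts trivially on that cycle, so it can only swap the two points left over.\<close>

lemma order_three_commuting_involution:
  fixes x y :: "'a \<Rightarrow> 'a"
  assumes S: "finite S" "card S \<le> 5" and x: "x permutes S" and y: "y permutes S"
    and x3: "x ^^ 3 = id" "x \<noteq> id" and y2: "y ^^ 2 = id" "y \<noteq> id" and xy: "x \<circ> y = y \<circ> x"
  obtains q r where "q \<noteq> r" "{z \<in> S. x z = z} = {q, r}" "y = transpose q r"
proof -
  have x3': "x (x (x z)) = z" for z
    using fun_cong[OF x3(1), of z] by (simp add: numeral_eq_Suc)
  have y2': "y (y z) = z" for z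
    using fun_cong[OF y2(1), of z] by (simp add: numeral_eq_Suc)
  have xy': "x (y z) = y (x z)" for z
    using fun_cong[OF xy, of z] by simp
  obtain p where p: "x p \<noteq> p"
    using x3(2) by (auto simp: fun_eq_iff)
  have inS: "z \<in> S" if "x z \<noteq> z" for z
    using x that by (meson permutes_not_in)
  have ne: "x p \<noteq> p" "x (x p) \<noteq> p" "x (x p) \<noteq> x p"
    using p x3' by metis+
  define O3 where "O3 = {p, x p, x (x p)}"
  have "O3 \<subseteq> S"
    using inS ne x3' unfolding O3_def by auto
  have "card O3 = 3"
    using ne by (auto simp: O3_def)
  have rest: "card (S - O3) \<le> 2"
    using \<open>O3 \<subseteq> S\<close> \<open>card O3 = 3\<close> S by (simp add: card_Diff_subset finite_subset)
  have inv: "x z \<notin> O3" if "z \<notin> O3" for z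
    using that x3' unfolding O3_def by auto metis+
  \<comment> \<open>A point moved outside \<open>O3\<close> would have an orbit of three points
    there, but at most two remain.\<close>
  have fix_rest: "x z = z" if "z \<notin> O3" for z
  proof (rule ccontr)
    assume nz: "x z \<noteq> z"
    have "x (x z) \<noteq> z" "x (x z) \<noteq> x z"
      using nz x3' by metis+
    then have "card {z, x z, x (x z)} = 3"
      using nz by auto
    moreover have "{z, x z, x (x z)} \<subseteq> S - O3"
      using inv that inS[OF nz] permutes_in_image[OF x] by auto
    ultimately show False
      using rest card_mono[of "S - O3" "{z, x z, x (x z)}"] S(1) by auto
  qed
  have O3: "O3 = {z. x z \<noteq> z}"
  proof -
    have "x z \<noteq> z" if "z \<in> O3" for z
      using that ne x3'[of p] unfolding O3_def by auto
    then show ?thesis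
      using fix_rest by blast
  qed
  \<comment> \<open>By commutation \<open>y\<close> preserves the set of points moved by
    \<open>x\<close>, so \<open>y p\<close> lies in \<open>O3\<close>. If \<open>y p\<close> were
    \<open>x p\<close> or \<open>x (x p)\<close>, then \<open>y (y p)\<close> would be
    \<open>x (x p)\<close> or \<open>x p\<close>, not \<open>p\<close>.\<close>
  have yp: "y p = p"
  proof -
    have "x (y p) \<noteq> y p"
      using ne(1) xy' y2' by metis
    then have "y p \<in> {p, x p, x (x p)}"
      using O3 by (auto simp: O3_def)
    then show ?thesis
      using y2'[of p] y2'[of "x p"] xy'[of p] ne x3'[of p] by auto
  qed
  then have yO3: "y z = z" if "z \<in> O3" for z
    using that xy' by (auto simp: O3_def simp flip: xy')
  obtain q where q: "y q \<noteq> q"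
    using y2(2) by (auto simp: fun_eq_iff)
  have qr: "q \<in> S - O3" "y q \<in> S - O3"
    using q y yO3 y2' by (metis DiffI permutes_not_in)+
  \<comment> \<open>A nontrivial 2-cycle of \<open>y\<close> already fills the remaining set of at
    most two points.\<close>
  have eq: "{q, y q} = S - O3"
    using qr q rest S(1) by (intro card_seteq) auto
  show ?thesis
  proof (rule that[of q "y q"])
    show "q \<noteq> y q" using q by simp
    show "{z \<in> S. x z = z} = {q, y q}"
      unfolding eq O3 by auto
    show "y = transpose q (y q)"
    proof
      fix z
      show "y z = transpose q (y q) z"
      proof (cases "z \<in> {q, y q}")
        case True
        then show ?thesis using y2' by auto
      next
        case False
        then have "y z = z"
          using eq yO3 y by (metis DiffI permutes_not_in)
        then show ?thesis using False by simp
      qed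
    qed
  qed
qed

text \<open>Both involutions are the transposition of the two fixed points of \<open>x\<close>, in
  whichever order these are named.\<close>

corollary order_three_commuting_involution_unique:
  fixes x y y' :: "'a \<Rightarrow> 'a"
  assumes "finite S" "card S \<le> 5" "x permutes S" "x ^^ 3 = id" "x \<noteq> id"
    and "y permutes S" "y ^^ 2 = id" "y \<noteq> id" "x \<circ> y = y \<circ> x"
    and "y' permutes S" "y' ^^ 2 = id" "y' \<noteq> id" "x \<circ> y' = y' \<circ> x"
  shows "y = y'"
proof -
  obtain q r where 1: "{z \<in> S. x z = z} = {q, r}" "y = transpose q r"
    using order_three_commuting_involution[of S x y] assms by metis
  obtain q' r' where 2: "{z \<in> S. x z = z} = {q', r'}" "y' = transpose q' r'"
    using order_three_commuting_involution[of S x y'] assms by metis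
  have "q = q' \<and> r = r' \<or> q = r' \<and> r = q'"
    using 1(1) 2(1) unfolding doubleton_eq_iff[symmetric] by simp
  then show ?thesis
    using 1 2 by (auto simp: transpose_commute)
qed

section \<open>Difference graphs of symmetric groups\<close>

text \<open>The middle edge of the path has an end of order 3. The two path neighbours of that end
  are commuting involutions of it, hence equal, against \<open>a \<noteq> c\<close> or
  \<open>b \<noteq> d\<close>.\<close>

lemma chordal_difference_graph_sym_group_5: "chordal (difference_graph (sym_group 5))"
proof (rule ccontr)
  let ?G = "sym_group 5"
  interpret group ?G by (rule sym_group_is_group)
  assume "\<not> chordal (difference_graph ?G)"
  then obtain a b c d where path: "(a, b) \<in> parcs (difference_graph ?G)"
    "(b, c) \<in> parcs (difference_graph ?G)" "(c, d) \<in> parcs (difference_graph ?G)" "a \<noteq> c" "b \<noteq> d"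
    by (rule not_chordal_path)
  have arc: "u ^^ 2 = id \<and> v ^^ 3 = id \<or> u ^^ 3 = id \<and> v ^^ 2 = id"
    "u \<circ> v = v \<circ> u" "u \<noteq> id" "v \<noteq> id" "u permutes {1..5}" "v permutes {1..5}"
    if uv: "(u, v) \<in> parcs (difference_graph ?G)" for u v
    using difference_graph_arcD[OF finite_carrier_sym_group _ uv] sym_group_5_exponent
      difference_graph_arc_commute[OF finite_carrier_sym_group uv]
      difference_graph_arc_neq_one[OF uv] uv
    by (simp_all add: sym_group_pow sym_group_carrier sym_group_one sym_group_mult
        difference_graph_arc_iff)
  \<comment> \<open>This excludes that both ends of an arc have order 3: a neighbour of an element
    killed by 3 must be an involution.\<close>
  have two_three: "u = id" if "u ^^ 2 = id" "u ^^ 3 = id" for u :: "nat \<Rightarrow> nat"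
    using that by (simp add: numeral_eq_Suc)
  have middle: "u = w" if "(u, v) \<in> parcs (difference_graph ?G)"
    "(v, w) \<in> parcs (difference_graph ?G)" "v ^^ 3 = id" for u v w
    using order_three_commuting_involution_unique[of "{1..5}" v u w] arc[OF that(1)] arc[OF that(2)]
      that(3) two_three by auto
  show False
    using arc(1)[OF path(2)] middle[OF path(1,2)] middle[OF path(2,3)] path(4,5) by blast
qed

lemma not_chordal_difference_graph_sym_group:
  assumes n: "n \<ge> 6"
  shows "\<not> chordal (difference_graph (sym_group n))"
proof -
  let ?G = "sym_group n"
  interpret group ?G by (rule sym_group_is_group)
  \<comment> \<open>\<open>t\<close> and \<open>u\<close> share the point 1 and so do not commute;
    \<open>s\<close> is the 3-cycle (3 4 5) and \<open>r\<close> its inverse, both disjoint from 1,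
    2 and 6. The point 6 is where \<open>n \<ge> 6\<close> enters.\<close>
  define t where "t = transpose (1::nat) 2"
  define u where "u = transpose (1::nat) 6"
  define s where "s = transpose (3::nat) 4 \<circ> transpose 4 5"
  define r where "r = transpose (4::nat) 5 \<circ> transpose 3 4"
  have carr: "t \<in> carrier ?G" "u \<in> carrier ?G" "s \<in> carrier ?G" "r \<in> carrier ?G"
    using n by (auto simp: t_def u_def s_def r_def sym_group_carrier
        intro!: permutes_swap_id permutes_compose)
  have arc: "(x, y) \<in> parcs (difference_graph ?G)" if "x \<in> {t, u}" "y \<in> {s, r}" for x y
  proof (rule difference_graph_arcI[OF finite_carrier_sym_group])
    show "x \<in> carrier ?G" "y \<in> carrier ?G"
      using that carr by auto
    show "x \<otimes>\<^bsub>?G\<^esub> y = y \<otimes>\<^bsub>?G\<^esub> x"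
      using that by (auto simp: sym_group_mult t_def u_def s_def r_def fun_eq_iff transpose_def)
    show "x [^]\<^bsub>?G\<^esub> (2::nat) = \<one>\<^bsub>?G\<^esub>"
      using that unfolding sym_group_pow sym_group_one
      by (auto simp: eval_nat_numeral t_def u_def)
    show "y [^]\<^bsub>?G\<^esub> (3::nat) = \<one>\<^bsub>?G\<^esub>"
      using that unfolding sym_group_pow sym_group_one
      by (auto simp: eval_nat_numeral s_def r_def fun_eq_iff transpose_def)
    \<comment> \<open>Both transpositions move 1 and both 3-cycles move 4.\<close>
    have "x 1 \<noteq> 1" "y 4 \<noteq> 4"
      using that by (auto simp: t_def u_def s_def r_def transpose_def)
    then show "x \<noteq> \<one>\<^bsub>?G\<^esub>" "y \<noteq> \<one>\<^bsub>?G\<^esub>"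
      by (auto simp: sym_group_one)
  qed
  have "t \<circ> u \<noteq> u \<circ> t"
    by (auto simp: t_def u_def fun_eq_iff transpose_def intro!: exI[of _ 1])
  then have tu: "(t, u) \<notin> parcs (difference_graph ?G)"
    using difference_graph_arc_commute[OF finite_carrier_sym_group] by (auto simp: sym_group_mult)
  \<comment> \<open>As a power of \<open>s\<close>, \<open>r\<close> is adjacent to \<open>s\<close>
    in the power graph, so this diagonal is absent; the other one fails by non-commutation.\<close>
  have "r = s [^]\<^bsub>?G\<^esub> (2::nat)"
    unfolding sym_group_pow by (auto simp: eval_nat_numeral s_def r_def fun_eq_iff transpose_def)
  then have sr: "(s, r) \<notin> parcs (difference_graph ?G)"
    using generate_singleton_iff[OF finite_carrier_sym_group carr(3)]
    by (auto simp: difference_graph_arc_iff)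
  have "t 1 \<noteq> u 1" "s 3 \<noteq> r 3"
    by (simp_all add: t_def u_def s_def r_def transpose_def)
  then have "t \<noteq> u" "s \<noteq> r" by auto
  then show ?thesis
    using induced_four_cycle_not_chordal[OF pair_graph_difference_graph[OF finite_carrier_sym_group],
        of t s n u r] arc tu sr
    by (simp add: difference_graph_arc_sym)
qed

theorem theorem5p1:
  fixes n :: nat
  assumes "n \<ge> 5"
  shows "chordal (difference_graph (sym_group n)) \<longleftrightarrow> n = 5"
  using assms chordal_difference_graph_sym_group_5 not_chordal_difference_graph_sym_group[of n]
  by (cases "n = 5") auto

end
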